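(* Let $h'$ be a Hessenberg function with degree tuple $\beta'=(\beta'_n,\ldots,\beta'_1)$. (1) For $i\in\{1,\ldots,n\}$ and any integer $d>\beta'_i$, we have $\tilde e_d(i,i+1,\ldots,n)\in J_{h'}$. (2) If $h$ is a Hessenberg function whose degree tuple $\beta$ satisfies $\beta>\beta'$, then $J_h\subseteq J_{h'}$.
   Context: A Hessenberg function is an $n$-tuple $h=(h_1,\ldots,h_n)$ of integers with $i\le h_i\le n$ and $h_i\le h_{i+1}$. Its degree tuple is $\beta=(\beta_n,\ldots,\beta_1)$ with $\beta_i=i-\#\{k:h_k<i\}$. Degree tuples are ordered componentwise: $\beta\ge\beta'$ iff $\beta_i\ge\beta'_i$ for all $i$, and $\beta>\beta'$ means $\beta\ge\beta'$, $\beta\neq\beta'$. For $S\subseteq\{1,\ldots,n\}$, $\tilde e_d(S)$ is the sum of all monomials (not necessarily squarefree) of degree $d$ in the variables $x_i$, $i\in S$ ($\tilde e_0(S)=1$), and $\tilde e_d(i,\ldots,n)$ means $S=\{i,\ldots,n\}$. $J_h$ is the ideal of $\mathbb{Z}[x_1,\ldots,x_n]$ generated by $\tilde e_{\beta_i}(i,\ldots,n)$, $i=1,\ldots,n$. *)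

theory Defs
  imports "HOL-Library.Poly_Mapping" "HOL-Algebra.Ideal"
begin

definition hessenberg :: "nat \<Rightarrow> (nat \<Rightarrow> nat) \<Rightarrow> bool" where
  "hessenberg n h \<longleftrightarrow>
     (\<forall>i\<in>{1..n}. i \<le> h i \<and> h i \<le> n) \<and> (\<forall>i\<in>{1..<n}. h i \<le> h (i + 1))"

text \<open>The entry \<open>\<beta>\<^sub>i\<close> of the degree tuple of \<open>h\<close>. For a Hessenberg function the subtraction does
  not truncate, as lemma \<open>card_less_index\<close> shows.\<close>

definition deg_tuple :: "nat \<Rightarrow> (nat \<Rightarrow> nat) \<Rightarrow> nat \<Rightarrow> nat" where
  "deg_tuple n h i = i - card {k \<in> {1..n}. h k < i}"

lemma card_less_index:
  assumes "hessenberg n h" "i \<in> {1..n}"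
  shows "card {k \<in> {1..n}. h k < i} < i"
proof -
  have "{k \<in> {1..n}. h k < i} \<subseteq> {1..<i}"
  proof
    fix k assume "k \<in> {k \<in> {1..n}. h k < i}"
    moreover from this have "k \<le> h k"
      using assms(1) by (simp add: hessenberg_def)
    ultimately show "k \<in> {1..<i}" by simp
  qed
  then have "card {k \<in> {1..n}. h k < i} \<le> card {1..<i}"
    by (intro card_mono) auto
  then show ?thesis using assms(2) by auto
qed

definition tuple_ge :: "nat \<Rightarrow> (nat \<Rightarrow> nat) \<Rightarrow> (nat \<Rightarrow> nat) \<Rightarrow> bool" where
  "tuple_ge n \<beta> \<beta>' \<longleftrightarrow> (\<forall>i\<in>{1..n}. \<beta> i \<ge> \<beta>' i)"

definition tuple_gt :: "nat \<Rightarrow> (nat \<Rightarrow> nat) \<Rightarrow> (nat \<Rightarrow> nat) \<Rightarrow> bool" where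
  "tuple_gt n \<beta> \<beta>' \<longleftrightarrow> tuple_ge n \<beta> \<beta>' \<and> (\<exists>i\<in>{1..n}. \<beta> i \<noteq> \<beta>' i)"

text \<open>A monomial is the finitely supported function sending each variable index to its exponent;
  an integer polynomial is a finitely supported function from monomials to coefficients.\<close>

type_synonym monom = "nat \<Rightarrow>\<^sub>0 nat"
type_synonym ipoly = "monom \<Rightarrow>\<^sub>0 int"

definition total_degree :: "monom \<Rightarrow> nat" where
  "total_degree m = (\<Sum>i\<in>Poly_Mapping.keys m. Poly_Mapping.lookup m i)"

text \<open>The ring \<open>\<int>[x\<^sub>1, \<dots>, x\<^sub>n]\<close>: the polynomials in which only the variables \<open>1, \<dots>, n\<close> occur.\<close>

definition polys_in :: "nat \<Rightarrow> ipoly set" where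
  "polys_in n = {p. \<forall>m\<in>Poly_Mapping.keys p. Poly_Mapping.keys m \<subseteq> {1..n}}"

definition poly_ring :: "nat \<Rightarrow> ipoly ring" where
  "poly_ring n = \<lparr>carrier = polys_in n, monoid.mult = (*), one = 1, zero = 0, add = (+)\<rparr>"

definition etilde :: "nat \<Rightarrow> nat set \<Rightarrow> ipoly" where
  "etilde d S =
     (\<Sum>m | Poly_Mapping.keys m \<subseteq> S \<and> total_degree m = d. Poly_Mapping.single m 1)"

definition hess_ideal :: "nat \<Rightarrow> (nat \<Rightarrow> nat) \<Rightarrow> ipoly set" where
  "hess_ideal n h = Idl\<^bsub>poly_ring n\<^esub> ((\<lambda>i. etilde (deg_tuple n h i) {i..n}) ` {1..n})"

lemma polys_in_closed:
  "0 \<in> polys_in n" "1 \<in> polys_in n"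
  "p \<in> polys_in n \<Longrightarrow> - p \<in> polys_in n"
  "p \<in> polys_in n \<Longrightarrow> q \<in> polys_in n \<Longrightarrow> p + q \<in> polys_in n"
  "p \<in> polys_in n \<Longrightarrow> q \<in> polys_in n \<Longrightarrow> p * q \<in> polys_in n"
proof -
  show "0 \<in> polys_in n" "1 \<in> polys_in n"
    by (auto simp: polys_in_def)
  show "p \<in> polys_in n \<Longrightarrow> - p \<in> polys_in n"
    by (auto simp: polys_in_def)
  show "p \<in> polys_in n \<Longrightarrow> q \<in> polys_in n \<Longrightarrow> p + q \<in> polys_in n"
    unfolding polys_in_def using Poly_Mapping.keys_add[of p q] by blast
  assume pq: "p \<in> polys_in n" "q \<in> polys_in n"
  show "p * q \<in> polys_in n"
    unfolding polys_in_def
  proof (intro CollectI ballI)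
    fix m assume "m \<in> Poly_Mapping.keys (p * q)"
    then obtain a b where ab: "m = a + b" "a \<in> Poly_Mapping.keys p" "b \<in> Poly_Mapping.keys q"
      using keys_mult[of p q] by blast
    then show "Poly_Mapping.keys m \<subseteq> {1..n}"
      using pq Poly_Mapping.keys_add[of a b] unfolding polys_in_def by blast
  qed
qed

lemma cring_poly_ring: "cring (poly_ring n)"
proof (rule cringI)
  show "abelian_group (poly_ring n)"
  proof (rule abelian_groupI)
    fix p assume "p \<in> carrier (poly_ring n)"
    then show "\<exists>q\<in>carrier (poly_ring n). q \<oplus>\<^bsub>poly_ring n\<^esub> p = \<zero>\<^bsub>poly_ring n\<^esub>"
      by (intro bexI[of _ "- p"]) (simp_all add: poly_ring_def polys_in_closed)
  qed (simp_all add: poly_ring_def polys_in_closed ac_simps)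
  show "comm_monoid (poly_ring n)"
    by (rule comm_monoidI) (simp_all add: poly_ring_def polys_in_closed ac_simps)
qed (simp add: poly_ring_def distrib_right)

text \<open>The index set of the sum defining \<open>etilde\<close> is finite, so the sum has its usual meaning.\<close>

lemma finite_monoms:
  assumes "finite S"
  shows "finite {m :: monom. Poly_Mapping.keys m \<subseteq> S \<and> total_degree m = d}"
    (is "finite ?M")
proof -
  have le: "Poly_Mapping.lookup m i \<le> d" if "total_degree m = d" for m :: monom and i
  proof (cases "i \<in> Poly_Mapping.keys m")
    case True
    then show ?thesis
      using that member_le_sum[of i "Poly_Mapping.keys m" "Poly_Mapping.lookup m"]
      by (simp add: total_degree_def)
  qed (simp add: in_keys_iff)
  have "Poly_Mapping.lookup ` ?M \<subseteq> {f. \<forall>i. (i \<in> S \<longrightarrow> f i \<in> {..d}) \<and> (i \<notin> S \<longrightarrow> f i = 0)}"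
    using le by (auto simp: in_keys_iff subset_iff)
  moreover have "finite {f :: nat \<Rightarrow> nat. \<forall>i. (i \<in> S \<longrightarrow> f i \<in> {..d}) \<and> (i \<notin> S \<longrightarrow> f i = 0)}"
    using assms by (intro finite_set_of_finite_funs) auto
  ultimately have "finite (Poly_Mapping.lookup ` ?M)"
    by (rule finite_subset)
  then show ?thesis
    by (rule finite_imageD) (rule inj_onI, rule poly_mapping_eqI, rule fun_cong)
qed

lemma lookup_etilde:
  assumes "finite S"
  shows "Poly_Mapping.lookup (etilde d S) m =
    (if Poly_Mapping.keys m \<subseteq> S \<and> total_degree m = d then 1 else 0)"
proof -
  let ?M = "{m :: monom. Poly_Mapping.keys m \<subseteq> S \<and> total_degree m = d}"
  have "Poly_Mapping.lookup (etilde d S) m =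
      (\<Sum>m'\<in>?M. Poly_Mapping.lookup (Poly_Mapping.single m' (1::int)) m)"
    unfolding etilde_def by (rule lookup_sum)
  also have "\<dots> = (\<Sum>m'\<in>?M. if m = m' then 1 else 0)"
    by (rule sum.cong) (auto simp: lookup_single when_def)
  also have "\<dots> = (if m \<in> ?M then 1 else 0)"
    by (rule sum.delta'[OF finite_monoms[OF assms]])
  finally show ?thesis by simp
qed

lemma etilde_in_polys:
  assumes "1 \<le> i"
  shows "etilde d {i..n} \<in> carrier (poly_ring n)"
proof -
  have "Poly_Mapping.keys m \<subseteq> {1..n}" if "m \<in> Poly_Mapping.keys (etilde d {i..n})" for m
  proof -
    have "Poly_Mapping.keys m \<subseteq> {i..n}"
      using that by (simp add: in_keys_iff lookup_etilde split: if_split_asm)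
    also have "{i..n} \<subseteq> {1..n}"
      using assms by simp
    finally show ?thesis .
  qed
  then show ?thesis
    by (simp add: poly_ring_def polys_in_def)
qed

end

theory Submission imports Defs begin

text \<open>Write \<open>e\<^sub>d\<close> for the paper's \<open>e\<close>-tilde. Sorting monomials by whether \<open>x\<^sub>i\<close> divides them gives
  \<open>e\<^sub>d(i,\<dots>,n) = x\<^sub>i e\<^sub>d\<^sub>-\<^sub>1(i,\<dots>,n) + e\<^sub>d(i+1,\<dots>,n)\<close>. As \<open>\<beta>\<^sub>i\<^sub>+\<^sub>1 \<le> \<beta>\<^sub>i + 1\<close>, membership of
  \<open>e\<^sub>d(i,\<dots>,n)\<close> in the ideal for all \<open>d \<ge> \<beta>\<^sub>i\<close> follows by descending induction on \<open>i\<close> and, for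
  fixed \<open>i\<close>, ascending induction on \<open>d\<close>. The inclusion of ideals compares generators.\<close>

lemma total_degree_eq_sum:
  assumes "finite A" "Poly_Mapping.keys m \<subseteq> A"
  shows "total_degree m = (\<Sum>i\<in>A. Poly_Mapping.lookup m i)"
  unfolding total_degree_def
  using assms by (intro sum.mono_neutral_left) (auto simp: in_keys_iff)

lemma total_degree_add: "total_degree (a + b) = total_degree a + total_degree b"
proof -
  let ?A = "Poly_Mapping.keys a \<union> Poly_Mapping.keys b"
  have "Poly_Mapping.keys (a + b) \<subseteq> ?A"
    by (rule Poly_Mapping.keys_add)
  then show ?thesis
    by (simp add: total_degree_eq_sum[of ?A] lookup_add sum.distrib)
qed

lemma total_degree_single: "total_degree (Poly_Mapping.single i k) = k"
  by (simp add: total_degree_eq_sum[of "{i}"])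

lemma etilde_Suc:
  assumes "finite S" "i \<in> S"
  shows "etilde (Suc d) S =
    Poly_Mapping.single (Poly_Mapping.single i 1) 1 * etilde d S + etilde (Suc d) (S - {i})"
proof -
  let ?M = "\<lambda>d S. {m :: monom. Poly_Mapping.keys m \<subseteq> S \<and> total_degree m = d}"
  let ?x = "Poly_Mapping.single i 1 :: monom"
  let ?f = "\<lambda>m :: monom. Poly_Mapping.single m (1::int)"
  have split: "?M (Suc d) S = (+) ?x ` ?M d S \<union> ?M (Suc d) (S - {i})"
  proof (intro equalityI subsetI)
    fix m assume m: "m \<in> ?M (Suc d) S"
    show "m \<in> (+) ?x ` ?M d S \<union> ?M (Suc d) (S - {i})"
    proof (cases "i \<in> Poly_Mapping.keys m")
      case True
      \<comment> \<open>Subtraction of exponents truncates at 0, but here the exponent of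
        \<open>i\<close> is at least 1, so dividing by the variable loses nothing.\<close>
      have eq: "m = ?x + (m - ?x)"
        using True by (intro poly_mapping_eqI)
          (auto simp: lookup_add lookup_minus lookup_single when_def in_keys_iff)
      have "Poly_Mapping.keys (m - ?x) \<subseteq> Poly_Mapping.keys m"
        by (auto simp: in_keys_iff lookup_minus)
      moreover have "Suc (total_degree (m - ?x)) = total_degree m"
        by (subst (2) eq) (simp add: total_degree_add total_degree_single)
      ultimately have "m - ?x \<in> ?M d S"
        using m by auto
      with eq show ?thesis by blast
    qed (use m in auto)
  next
    fix m assume "m \<in> (+) ?x ` ?M d S \<union> ?M (Suc d) (S - {i})"
    then show "m \<in> ?M (Suc d) S"
    proof
      assume "m \<in> (+) ?x ` ?M d S"
      then obtain m' where m': "m = ?x + m'" "m' \<in> ?M d S" by blast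
      then have "Poly_Mapping.keys m \<subseteq> S"
        using Poly_Mapping.keys_add[of ?x m'] assms(2) by auto
      with m' show ?thesis
        by (simp add: total_degree_add total_degree_single)
    qed auto
  qed
  \<comment> \<open>The exponent of \<open>i\<close> is positive on the left and zero on the
    right.\<close>
  have disj: "(+) ?x ` ?M d S \<inter> ?M (Suc d) (S - {i}) = {}"
    by (force simp: subset_iff in_keys_iff lookup_add dest: spec[of _ i])
  have "etilde (Suc d) S = sum ?f ((+) ?x ` ?M d S) + etilde (Suc d) (S - {i})"
    unfolding etilde_def split
    using assms(1) disj by (intro sum.union_disjoint) (auto intro!: finite_imageI finite_monoms)
  also have "sum ?f ((+) ?x ` ?M d S) = ?f ?x * etilde d S"
    by (simp add: etilde_def sum.reindex sum_distrib_left mult_single)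
  finally show ?thesis .
qed

lemma etilde_Suc_empty: "etilde (Suc d) {} = 0"
  by (simp add: etilde_def total_degree_def)

text \<open>The set of \<open>k\<close> with \<open>h k < i\<close> can only grow with
  \<open>i\<close>, so the subtracted cardinality does not drop.\<close>

lemma deg_tuple_Suc_le: "deg_tuple n h (Suc i) \<le> Suc (deg_tuple n h i)"
proof -
  have "card {k \<in> {1..n}. h k < i} \<le> card {k \<in> {1..n}. h k < Suc i}"
    by (intro card_mono) auto
  then show ?thesis
    by (simp add: deg_tuple_def)
qed

lemma ideal_hess_ideal: "ideal (hess_ideal n h) (poly_ring n)"
  unfolding hess_ideal_def
  by (intro ring.genideal_ideal cring.axioms(1) cring_poly_ring) (auto intro: etilde_in_polys)

lemma etilde_generator_mem_hess_ideal:
  assumes "i \<in> {1..n}"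
  shows "etilde (deg_tuple n h i) {i..n} \<in> hess_ideal n h"
proof -
  have "(\<lambda>i. etilde (deg_tuple n h i) {i..n}) ` {1..n} \<subseteq> hess_ideal n h"
    unfolding hess_ideal_def
    by (intro ring.genideal_self cring.axioms(1) cring_poly_ring) (auto intro: etilde_in_polys)
  with assms show ?thesis by blast
qed

text \<open>The bound is not strict: equality is the generator itself, which starts the induction on
  \<open>d\<close>, and it covers the indices where two degree tuples agree.\<close>

lemma etilde_mem_hess_ideal:
  assumes "i \<in> {1..n}" "deg_tuple n h i \<le> d"
  shows "etilde d {i..n} \<in> hess_ideal n h"
  using assms
\<comment> \<open>\<open>d\<close> must vary, since the tail at index \<open>Suc i\<close> is needed
  in degree \<open>Suc d\<close>.\<close>
proof (induction "n - i" arbitrary: i d)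
  interpret I: ideal "hess_ideal n h" "poly_ring n"
    by (rule ideal_hess_ideal)
  have add: "p + q \<in> hess_ideal n h" if "p \<in> hess_ideal n h" "q \<in> hess_ideal n h" for p q
    using additive_subgroup.a_closed[OF I.additive_subgroup_axioms that] by (simp add: poly_ring_def)
  \<comment> \<open>The inner induction on \<open>d\<close>, shared by both cases of the outer one,
    which differ only in how they supply \<open>tail\<close>.\<close>
  have step: "etilde d {i..n} \<in> hess_ideal n h"
    if i: "i \<in> {1..n}" and "deg_tuple n h i \<le> d"
      and tail: "\<And>d. deg_tuple n h i \<le> d \<Longrightarrow> etilde (Suc d) {Suc i..n} \<in> hess_ideal n h" for i d
    using that(2)
  proof (induction d rule: dec_induct)
    case base
    show ?case using i by (rule etilde_generator_mem_hess_ideal)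
  next
    case (step d)
    let ?x = "Poly_Mapping.single (Poly_Mapping.single i 1) 1 :: ipoly"
    have "?x \<in> carrier (poly_ring n)"
      using i by (simp add: poly_ring_def polys_in_def)
    from I.I_l_closed[OF step.IH this] have "?x * etilde d {i..n} \<in> hess_ideal n h"
      by (simp add: poly_ring_def)
    moreover have "{i..n} - {i} = {Suc i..n}" by auto
    ultimately show ?case
      using add tail[OF step.hyps(1)] i by (simp add: etilde_Suc[of "{i..n}" i])
  qed
  {
    case 0
    then have "i = n" by simp
    \<comment> \<open>No variables remain beyond \<open>n\<close>, so the tail is a sum of positive
      degree over no variables, hence 0.\<close>
    have "etilde (Suc d) {Suc i..n} \<in> hess_ideal n h" for d
      using additive_subgroup.zero_closed[OF I.additive_subgroup_axioms]
      by (simp add: \<open>i = n\<close> etilde_Suc_empty poly_ring_def)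
    then show ?case by (rule step[OF 0(2,3)])
  next
    case (Suc k)
    have "etilde (Suc d) {Suc i..n} \<in> hess_ideal n h" if "deg_tuple n h i \<le> d" for d
      \<comment> \<open>The outer hypothesis applies at \<open>Suc i\<close> in degree
        \<open>Suc d\<close>, as \<open>deg_tuple n h (Suc i)\<close> is at most
        \<open>Suc (deg_tuple n h i)\<close>, hence at most \<open>Suc d\<close>.\<close>
      using Suc.hyps(2) that deg_tuple_Suc_le[of n h i] by (intro Suc.hyps(1)) auto
    then show ?case by (rule step[OF Suc.prems])
  }
qed

theorem theorem5p3:
  fixes n :: nat and h' :: "nat \<Rightarrow> nat"
  assumes "hessenberg n h'"
  shows "(\<forall>i\<in>{1..n}. \<forall>d. d > deg_tuple n h' i \<longrightarrow> etilde d {i..n} \<in> hess_ideal n h') \<and>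
         (\<forall>h. hessenberg n h \<longrightarrow> tuple_gt n (deg_tuple n h) (deg_tuple n h') \<longrightarrow>
              hess_ideal n h \<subseteq> hess_ideal n h')"
proof (intro conjI ballI allI impI)
  fix i d assume "i \<in> {1..n}" "d > deg_tuple n h' i"
  then show "etilde d {i..n} \<in> hess_ideal n h'"
    by (intro etilde_mem_hess_ideal) auto
next
  fix h assume "tuple_gt n (deg_tuple n h) (deg_tuple n h')"
  \<comment> \<open>Each generator of the smaller ideal has degree at least the entry of
    \<open>h'\<close> at the same index.\<close>
  then have "(\<lambda>i. etilde (deg_tuple n h i) {i..n}) ` {1..n} \<subseteq> hess_ideal n h'"
    by (auto simp: tuple_gt_def tuple_ge_def intro!: etilde_mem_hess_ideal)
  then show "hess_ideal n h \<subseteq> hess_ideal n h'"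
    unfolding hess_ideal_def[of n h]
    by (intro ring.genideal_minimal cring.axioms(1) cring_poly_ring ideal_hess_ideal)
qed

end
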